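(* Let $X$ be a finite non-empty set and $R$ a monotone transit function on $X$. Then $R$ satisfies (w) if and only if it satisfies both (mm) and (x'), where: (w) for all $x,y,z\in X$: $z\in R(x,y)$ or $y\in R(x,z)$ or $x\in R(y,z)$; (mm) for all $x,y,u,v\in X$: if $R(x,y)\cap R(u,v)\neq\emptyset$ then there are $p,q\in R(x,y)\cup R(u,v)$ with $R(x,y)\cup R(u,v)\subseteq R(p,q)$; (x') for all $x,y,z\in X$: if $z\notin R(x,y)$ then $R(x,y)\subseteq R(x,z)\cup R(z,y)$.
   Context: A transit function on a finite non-empty set $X$ is a map $R:X\times X\to 2^X$ such that for all $u,v\in X$: $u\in R(u,v)$, $R(u,v)=R(v,u)$, and $R(u,u)=\{u\}$. $R$ is monotone if for all $u,v,p,q\in X$, $p,q\in R(u,v)$ implies $R(p,q)\subseteq R(u,v)$. *)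

theory Defs
  imports Main
begin

text \<open>Transit functions are curried, and only their values at arguments from the carrier
  set \<open>X\<close> matter.\<close>

definition transit_function :: "'a set \<Rightarrow> ('a \<Rightarrow> 'a \<Rightarrow> 'a set) \<Rightarrow> bool" where
  "transit_function X R \<longleftrightarrow>
     (\<forall>u\<in>X. \<forall>v\<in>X. R u v \<subseteq> X) \<and>
     (\<forall>u\<in>X. \<forall>v\<in>X. u \<in> R u v) \<and>
     (\<forall>u\<in>X. \<forall>v\<in>X. R u v = R v u) \<and>
     (\<forall>u\<in>X. R u u = {u})"

definition monotone_transit :: "'a set \<Rightarrow> ('a \<Rightarrow> 'a \<Rightarrow> 'a set) \<Rightarrow> bool" where
  "monotone_transit X R \<longleftrightarrow>
     (\<forall>u\<in>X. \<forall>v\<in>X. \<forall>p\<in>X. \<forall>q\<in>X. p \<in> R u v \<and> q \<in> R u v \<longrightarrow> R p q \<subseteq> R u v)"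

definition axiom_w :: "'a set \<Rightarrow> ('a \<Rightarrow> 'a \<Rightarrow> 'a set) \<Rightarrow> bool" where
  "axiom_w X R \<longleftrightarrow>
     (\<forall>x\<in>X. \<forall>y\<in>X. \<forall>z\<in>X. z \<in> R x y \<or> y \<in> R x z \<or> x \<in> R y z)"

definition axiom_mm :: "'a set \<Rightarrow> ('a \<Rightarrow> 'a \<Rightarrow> 'a set) \<Rightarrow> bool" where
  "axiom_mm X R \<longleftrightarrow>
     (\<forall>x\<in>X. \<forall>y\<in>X. \<forall>u\<in>X. \<forall>v\<in>X. R x y \<inter> R u v \<noteq> {} \<longrightarrow>
        (\<exists>p \<in> R x y \<union> R u v. \<exists>q \<in> R x y \<union> R u v. R x y \<union> R u v \<subseteq> R p q))"

definition axiom_x' :: "'a set \<Rightarrow> ('a \<Rightarrow> 'a \<Rightarrow> 'a set) \<Rightarrow> bool" where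
  "axiom_x' X R \<longleftrightarrow>
     (\<forall>x\<in>X. \<forall>y\<in>X. \<forall>z\<in>X. z \<notin> R x y \<longrightarrow> R x y \<subseteq> R x z \<union> R z y)"

end

theory Submission
  imports Defs
begin

text \<open>Under (w) and monotonicity, a single interval \<open>R p q\<close> with \<open>p, q \<in> S\<close> covers any finite
  non-empty \<open>S\<close>: when a point \<open>z\<close> outside \<open>R p q\<close> is added, (w) allows one of \<open>p, q\<close> to be replaced
  by \<open>z\<close>. Conversely, suppose (w) fails for \<open>x, y, z\<close>. By (x') any two of the three intervals on these
  points cover the third. The interval \<open>R p q\<close> given by (mm) for \<open>R x y\<close> and \<open>R x z\<close> contains all
  three points, while each of \<open>p, q\<close> lies in at least two of the three intervals. Hence some interval
  contains both, and by monotonicity it contains \<open>x, y, z\<close>, a contradiction.\<close>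

lemma transit_function_subset:
  "\<lbrakk>transit_function X R; u \<in> X; v \<in> X\<rbrakk> \<Longrightarrow> R u v \<subseteq> X"
  by (simp add: transit_function_def)

lemma transit_function_left:
  "\<lbrakk>transit_function X R; u \<in> X; v \<in> X\<rbrakk> \<Longrightarrow> u \<in> R u v"
  by (simp add: transit_function_def)

lemma transit_function_commute:
  "\<lbrakk>transit_function X R; u \<in> X; v \<in> X\<rbrakk> \<Longrightarrow> R u v = R v u"
  by (simp add: transit_function_def)

lemma transit_function_right:
  "\<lbrakk>transit_function X R; u \<in> X; v \<in> X\<rbrakk> \<Longrightarrow> v \<in> R u v"
  using transit_function_left transit_function_commute by metis

lemma monotone_transitD:
  assumes "transit_function X R" "monotone_transit X R"
    and "u \<in> X" "v \<in> X" "p \<in> R u v" "q \<in> R u v"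
  shows "R p q \<subseteq> R u v"
  using assms transit_function_subset[of X R u v] unfolding monotone_transit_def by blast

text \<open>Stated for arbitrary finite non-empty \<open>S\<close> so that induction can add one
  point at a time; (mm) is the case where \<open>S\<close> is a union of two intervals.\<close>

lemma axiom_w_imp_spanning_pair:
  assumes T: "transit_function X R" and M: "monotone_transit X R" and W: "axiom_w X R"
    and "finite S" "S \<noteq> {}" "S \<subseteq> X"
  shows "\<exists>p\<in>S. \<exists>q\<in>S. S \<subseteq> R p q"
  using assms(4-6)
proof (induction S rule: finite_ne_induct)
  case (singleton x)
  then show ?case using transit_function_left[OF T] by simp
next
  case (insert z S)
  then obtain p q where pq: "p \<in> S" "q \<in> S" "S \<subseteq> R p q" by auto
  with insert.prems have X: "p \<in> X" "q \<in> X" "z \<in> X" by auto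
  consider "z \<in> R p q" | "q \<in> R p z" | "p \<in> R q z"
    using W X unfolding axiom_w_def by blast
  then show ?case
  proof cases
    case 1
    then show ?thesis using pq by blast
  next
    case 2
    \<comment> \<open>Both \<open>p\<close> and \<open>q\<close> lie in \<open>R p z\<close>, so
      monotonicity applies and the pair \<open>p, z\<close> replaces \<open>p, q\<close>.\<close>
    have "R p q \<subseteq> R p z"
      using monotone_transitD[OF T M] X 2 transit_function_left[OF T] by simp
    moreover have "z \<in> R p z" using transit_function_right[OF T] X by simp
    ultimately show ?thesis using pq by blast
  next
    case 3
    have "R p q \<subseteq> R q z"
      using monotone_transitD[OF T M] X 3 transit_function_left[OF T] by simp
    moreover have "z \<in> R q z" using transit_function_right[OF T] X by simp
    ultimately show ?thesis using pq by blast
  qed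
qed

lemma axiom_w_imp_axiom_mm:
  assumes "finite X" and T: "transit_function X R" and M: "monotone_transit X R"
    and W: "axiom_w X R"
  shows "axiom_mm X R"
  unfolding axiom_mm_def
proof (intro ballI impI)
  fix x y u v
  assume "x \<in> X" "y \<in> X" "u \<in> X" "v \<in> X" and ne: "R x y \<inter> R u v \<noteq> {}"
  then have "R x y \<union> R u v \<subseteq> X" using transit_function_subset[OF T] by simp
  then show "\<exists>p \<in> R x y \<union> R u v. \<exists>q \<in> R x y \<union> R u v. R x y \<union> R u v \<subseteq> R p q"
    using axiom_w_imp_spanning_pair[OF T M W, of "R x y \<union> R u v"] \<open>finite X\<close> ne
    by (auto dest: finite_subset)
qed

text \<open>If \<open>z\<close> is outside \<open>R x y\<close>, (w) puts \<open>y\<close> in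
  \<open>R x z\<close> or \<open>x\<close> in \<open>R z y\<close>. That interval then contains both
  \<open>x\<close> and \<open>y\<close>, so by monotonicity it alone contains
  \<open>R x y\<close>.\<close>

lemma axiom_w_imp_axiom_x':
  assumes T: "transit_function X R" and M: "monotone_transit X R" and W: "axiom_w X R"
  shows "axiom_x' X R"
  unfolding axiom_x'_def
proof (intro ballI impI)
  fix x y z
  assume X: "x \<in> X" "y \<in> X" "z \<in> X" and "z \<notin> R x y"
  then consider "y \<in> R x z" | "x \<in> R z y"
    using W transit_function_commute[OF T, of y z] unfolding axiom_w_def by blast
  then show "R x y \<subseteq> R x z \<union> R z y"
    using monotone_transitD[OF T M] X transit_function_left[OF T] transit_function_right[OF T]
    by cases (simp_all add: le_supI1 le_supI2)
qed

lemma axiom_mm_x'_imp_axiom_w: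
  assumes T: "transit_function X R" and M: "monotone_transit X R"
    and MM: "axiom_mm X R" and X': "axiom_x' X R"
  shows "axiom_w X R"
  unfolding axiom_w_def
proof (intro ballI, rule ccontr)
  fix x y z
  assume X: "x \<in> X" "y \<in> X" "z \<in> X" and "\<not> (z \<in> R x y \<or> y \<in> R x z \<or> x \<in> R y z)"
  then have no: "z \<notin> R x y" "y \<notin> R x z" "x \<notin> R y z" by auto
  note comm = transit_function_commute[OF T]
  \<comment> \<open>One instance of (x') for each of the three non-memberships in
    \<open>no\<close>.\<close>
  have cover: "R x y \<subseteq> R x z \<union> R y z" "R x z \<subseteq> R x y \<union> R y z" "R y z \<subseteq> R x y \<union> R x z"
    using X' X no comm[of z y] comm[of y x] unfolding axiom_x'_def by blast+
  have "x \<in> R x y \<inter> R x z" using transit_function_left[OF T] X by simp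
  then obtain p q where p: "p \<in> R x y \<union> R x z" and q: "q \<in> R x y \<union> R x z"
    and sub: "R x y \<union> R x z \<subseteq> R p q"
    using MM X unfolding axiom_mm_def by (metis empty_iff)
  have xyz: "x \<in> R p q" "y \<in> R p q" "z \<in> R p q"
    using sub X transit_function_left[OF T] transit_function_right[OF T] by blast+
  \<comment> \<open>Pigeonhole: by \<open>cover\<close>, a point of one interval lies in a second
    one, and any two choices of two intervals out of three share one.\<close>
  have "(p \<in> R x y \<and> q \<in> R x y) \<or> (p \<in> R x z \<and> q \<in> R x z) \<or> (p \<in> R y z \<and> q \<in> R y z)"
    using p q cover by blast
  then show False
    using monotone_transitD[OF T M] X xyz no by blast
qed

theorem theorem3:
  fixes X :: "'a set" and R :: "'a \<Rightarrow> 'a \<Rightarrow> 'a set"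
  assumes "finite X" and "X \<noteq> {}"
    and "transit_function X R" and "monotone_transit X R"
  shows "axiom_w X R \<longleftrightarrow> axiom_mm X R \<and> axiom_x' X R"
  using assms axiom_w_imp_axiom_mm axiom_w_imp_axiom_x' axiom_mm_x'_imp_axiom_w by blast

end
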